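(* Let $N\ge1$ and $\Phi(r)=|r|^{m-1}r$ with $$0<m<1\quad\text{if }N=1,2,\qquad \frac{N-2}{N}\le m<1\quad\text{if }N\ge3.$$ Let $k,\ell$ be kernels as in the context. Let $u\in C([0,\infty);L^1(\mathbb{R}^N))$ be an $L^1$-solution to the Cauchy problem $$\partial_t\left(k*[u-u_0]\right)=\Delta\Phi(u)\ \text{ in }\mathbb{R}^N\times(0,\infty),\qquad u(x,0)=u_0(x)\ \text{ in }\mathbb{R}^N,$$ with initial data $u_0\in L^1(\mathbb{R}^N)$. Then $$\int_{\mathbb{R}^N}u(x,t)\,dx=\int_{\mathbb{R}^N}u_0(x)\,dx,\qquad t>0.$$
   Context: Convolution in time: $(k*v)(t):=\int_0^t k(t-\tau)v(\tau)\,d\tau$ for $t\ge0$. Kernels: $k\in L^1_{\rm loc}([0,\infty))$ is a nonnegative nonincreasing function, and $\ell\in L^1_{\rm loc}([0,\infty))$ is a nonnegative nonincreasing function such that $(k*\ell)(t)\equiv1$. Definition ($L^1$-solution). For $u_0\in L^1(\mathbb{R}^N)$, $u$ is an $L^1$-solution to the Cauchy problem with initial data $u_0$ if (i) $u\in L^\infty(0,\infty;L^1(\mathbb{R}^N))$; (ii) $\Phi(u)\in L^1_{\rm loc}(0,\infty;L^1_{\rm loc}(\mathbb{R}^N))$ with $\ell*\|\Phi(u)\|_{L^1_{\rm loc}(\mathbb{R}^N)}\in L^\infty(0,\infty)$; (iii) for every $\phi\in C_0^\infty(\mathbb{R}^N)$, $$\int_{\mathbb{R}^N}(u(x,t)-u_0(x))\phi(x)\,dx=\left(\ell*\left[\int_{\mathbb{R}^N}\Phi(u(x,\cdot))\Delta\phi(x)\,dx\right]\right)(t)\quad\text{for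 a.e. }t>0.$$ Conventions: a statement about $\ell*\|\Phi(u)\|_{L^1_{\rm loc}(\mathbb{R}^N)}$ means that the statement holds for $t\mapsto(\ell*\|\Phi(u)\|_{L^1(B_M)})(t)$ for every ball $B_M=\{|x|<M\}$, $M>0$. $L^1_{\rm loc}(0,\infty;\cdot)$ means $L^1(0,T;\cdot)$ for every $T>0$. *)

theory Defs
  imports "HOL-Analysis.Analysis"
begin

section \<open>Smooth compactly supported functions on $R^N$\<close>

definition partial_deriv :: "'n \<Rightarrow> (real ^ 'n \<Rightarrow> real) \<Rightarrow> real ^ 'n \<Rightarrow> real" where
  "partial_deriv i f x = frechet_derivative f (at x) (axis i 1)"

primrec Ck_function :: "nat \<Rightarrow> (real ^ 'n \<Rightarrow> real) \<Rightarrow> bool" where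
  "Ck_function 0 f \<longleftrightarrow> continuous_on UNIV f"
| "Ck_function (Suc k) f \<longleftrightarrow>
     (\<forall>x. f differentiable (at x)) \<and> (\<forall>i. Ck_function k (partial_deriv i f))"

definition test_function :: "(real ^ 'n \<Rightarrow> real) \<Rightarrow> bool" where
  "test_function \<phi> \<longleftrightarrow> (\<forall>k. Ck_function k \<phi>) \<and> compact (closure {x. \<phi> x \<noteq> 0})"

definition laplacian :: "(real ^ 'n \<Rightarrow> real) \<Rightarrow> real ^ 'n \<Rightarrow> real" where
  "laplacian \<phi> x = (\<Sum>i\<in>UNIV. partial_deriv i (partial_deriv i \<phi>) x)"

section \<open>Convolution in time and kernels\<close>

definition time_conv :: "(real \<Rightarrow> real) \<Rightarrow> (real \<Rightarrow> real) \<Rightarrow> real \<Rightarrow> real" where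
  "time_conv k v t = (LINT \<tau>:{0..t}|lebesgue. k (t - \<tau>) * v \<tau>)"

text \<open>Sign and monotonicity are imposed on the open half-line: a kernel such as $t^{-a}$ is
  unbounded at 0, and its value at 0 is immaterial.  Likewise the identity $k * l = 1$ can only
  hold for positive times, the convolution being an integral over a null set at time 0.\<close>

definition kernel_function :: "(real \<Rightarrow> real) \<Rightarrow> bool" where
  "kernel_function k \<longleftrightarrow>
     (\<forall>T>0. set_integrable lebesgue {0..T} k) \<and>
     (\<forall>t>0. 0 \<le> k t) \<and> antimono_on {0<..} k"

definition kernel_pair :: "(real \<Rightarrow> real) \<Rightarrow> (real \<Rightarrow> real) \<Rightarrow> bool" where
  "kernel_pair k l \<longleftrightarrow>
     kernel_function k \<and> kernel_function l \<and> (\<forall>t>0. time_conv k l t = 1)"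

section \<open>Spaces of functions of time with values in $L^1(A)$\<close>

text \<open>A function of time with values in $L^1(A)$ is given by a family of representatives; all
  notions below depend only on their classes modulo equality almost everywhere on \<open>A\<close>.\<close>

definition L1_norm :: "(real ^ 'n) set \<Rightarrow> (real ^ 'n \<Rightarrow> real) \<Rightarrow> real" where
  "L1_norm A g = (LINT x:A|lebesgue. \<bar>g x\<bar>)"

definition continuous_L1 ::
    "real set \<Rightarrow> (real ^ 'n) set \<Rightarrow> (real \<Rightarrow> real ^ 'n \<Rightarrow> real) \<Rightarrow> bool" where
  "continuous_L1 I A f \<longleftrightarrow>
     (\<forall>t\<in>I. set_integrable lebesgue A (f t)) \<and>
     (\<forall>t\<in>I. ((\<lambda>s. L1_norm A (\<lambda>x. f s x - f t x)) \<longlongrightarrow> 0) (at t within I))"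

text \<open>Bochner (strong) measurability: almost everywhere limit, in the norm of $L^1(A)$, of
  measurable functions with finitely many values.\<close>

definition strongly_measurable_L1 ::
    "real set \<Rightarrow> (real ^ 'n) set \<Rightarrow> (real \<Rightarrow> real ^ 'n \<Rightarrow> real) \<Rightarrow> bool" where
  "strongly_measurable_L1 I A f \<longleftrightarrow>
     (AE t in lebesgue. t \<in> I \<longrightarrow> set_integrable lebesgue A (f t)) \<and>
     (\<exists>s :: nat \<Rightarrow> real \<Rightarrow> real ^ 'n \<Rightarrow> real.
        (\<forall>n. finite (s n ` I) \<and>
             (\<forall>g. {t \<in> I. s n t = g} \<in> sets lebesgue) \<and>
             (\<forall>t\<in>I. set_integrable lebesgue A (s n t))) \<and>
        (AE t in lebesgue. t \<in> I \<longrightarrow>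
             (\<lambda>n. L1_norm A (\<lambda>x. s n t x - f t x)) \<longlonglongrightarrow> 0))"

definition L1_time_L1 ::
    "real set \<Rightarrow> (real ^ 'n) set \<Rightarrow> (real \<Rightarrow> real ^ 'n \<Rightarrow> real) \<Rightarrow> bool" where
  "L1_time_L1 I A f \<longleftrightarrow>
     strongly_measurable_L1 I A f \<and> set_integrable lebesgue I (\<lambda>t. L1_norm A (f t))"

definition Linf :: "real set \<Rightarrow> (real \<Rightarrow> real) \<Rightarrow> bool" where
  "Linf I h \<longleftrightarrow>
     set_borel_measurable lebesgue I h \<and> (\<exists>C. AE t in lebesgue. t \<in> I \<longrightarrow> \<bar>h t\<bar> \<le> C)"

definition Linf_time_L1 ::
    "real set \<Rightarrow> (real ^ 'n) set \<Rightarrow> (real \<Rightarrow> real ^ 'n \<Rightarrow> real) \<Rightarrow> bool" where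
  "Linf_time_L1 I A f \<longleftrightarrow>
     strongly_measurable_L1 I A f \<and> Linf I (\<lambda>t. L1_norm A (f t))"

section \<open>$L^1$-solutions\<close>

definition \<Phi> :: "real \<Rightarrow> real \<Rightarrow> real" where
  "\<Phi> m r = \<bar>r\<bar> powr (m - 1) * r"

text \<open>Only \<open>l\<close> enters: this is the integrated form of
  $\partial_t (k * [u - u_0]) = \Delta \Phi(u)$, obtained by convolving with \<open>l\<close>.
  As in the source, local integrability in time means integrability on $(0,T)$ for every \<open>T > 0\<close>,
  and local integrability in space is tested on the balls centred at the origin.\<close>

definition L1_solution ::
    "real \<Rightarrow> (real \<Rightarrow> real) \<Rightarrow> (real ^ 'n \<Rightarrow> real) \<Rightarrow> (real \<Rightarrow> real ^ 'n \<Rightarrow> real) \<Rightarrow> bool" where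
  "L1_solution m l u0 u \<longleftrightarrow>
     Linf_time_L1 {0<..} UNIV u \<and>
     (\<forall>T>0. \<forall>M>0. L1_time_L1 {0<..<T} (ball 0 M) (\<lambda>t x. \<Phi> m (u t x))) \<and>
     (\<forall>M>0. Linf {0<..} (time_conv l (\<lambda>t. L1_norm (ball 0 M) (\<lambda>x. \<Phi> m (u t x))))) \<and>
     (\<forall>\<phi>. test_function \<phi> \<longrightarrow>
        (AE t in lebesgue. t > 0 \<longrightarrow>
           (LINT x|lebesgue. (u t x - u0 x) * \<phi> x) =
           time_conv l (\<lambda>\<tau>. LINT x|lebesgue. \<Phi> m (u \<tau> x) * laplacian \<phi> x) t))"

end

theory Submission
  imports Defs "HOL-Computational_Algebra.Polynomial"
begin

text \<open>The mass is read off from the weak formulation by testing with cutoffs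
  $\phi_R(x) = \phi(x/R)$, where $\phi$ is 1 on the unit ball and 0 outside the ball of radius 2,
  and letting $R \to \infty$.  The left-hand side converges to $\int (u(t) - u_0)$ by dominated
  convergence (\<open>integral_times_scaled_bump_tendsto\<close>), so everything rests on the
  vanishing of the diffusion term on the right (\<open>time_conv_diffusion_term_tendsto_0\<close>).

  Write $N$ for the dimension.  The Laplacian of $\phi_R$ is of size $R^{-2}$ and lives on the
  annulus $R \le |x| \le 2R$, of volume of order $R^N$.  By Hoelder's inequality the diffusion term
  at a time $\tau$ is therefore at most a constant times
  $R^{N(1-m)-2} (\int_{|x| \ge R} |u(\tau)|)^m$.  The hypothesis on $m$ says that the exponent
  of $R$ is not positive, and the tail of an integrable function tends to 0; thus the term vanishes
  pointwise in $\tau$ even for the critical exponent $m = (N-2)/N$.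

  Instead of Hoelder's inequality, the pointwise bound
  $a^m \le s^{m-1} a + s^m$ is used with $s = \varepsilon R^{-N}$
  (\<open>diffusion_term_bound\<close>).  It estimates the term by
  $\varepsilon^{m-1} \int_{|x| \ge R} |u(\tau)|$ plus a constant times $\varepsilon^m$.
  For fixed $\varepsilon$, the convolution in time of the first summand with $l$ tends to 0 by
  dominated convergence: continuity in $L^1$ bounds the norm of $u(\tau)$ on $[0,t]$, and $l$ is
  integrable there.  The second summand is then removed by letting $\varepsilon \to 0$.

  This gives conservation of mass for almost every $t$, hence for every $t$ because
  $u$ is continuous with values in $L^1$.\<close>

section \<open>Calculus of $C^k$ functions\<close>

lemma partial_deriv_eq:
  assumes "(f has_derivative f') (at x)"
  shows "partial_deriv i f x = f' (axis i 1)"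
  using frechet_derivative_at[OF assms] by (simp add: partial_deriv_def)

text \<open>For a real-valued function, all derivatives of order \<open>Suc k\<close> are handled at once by
  giving the full derivative \<open>f' x\<close> and evaluating it on the coordinate directions; this lets
  the rules of differential calculus be used as they are, and reduces each closure property
  below to an induction on \<open>k\<close>.\<close>

lemma Ck_function_SucI:
  assumes "\<And>x. (f has_derivative f' x) (at x)"
    and "\<And>i. Ck_function k (\<lambda>x. f' x (axis i 1))"
  shows "Ck_function (Suc k) f"
proof -
  have "partial_deriv i f = (\<lambda>x. f' x (axis i 1))" for i
    using partial_deriv_eq[OF assms(1)] by blast
  then show ?thesis
    using assms by (auto simp: differentiable_def)
qed

lemma Ck_function_SucD:
  assumes "Ck_function (Suc k) f"
  shows "(f has_derivative frechet_derivative f (at x)) (at x)"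
    and "Ck_function k (\<lambda>x. frechet_derivative f (at x) (axis i 1))"
  using assms
  by (auto simp: frechet_derivative_works partial_deriv_def[abs_def])

lemma Ck_function_continuous: "Ck_function k f \<Longrightarrow> continuous_on UNIV f"
  by (cases k)
    (auto intro!: differentiable_imp_continuous_on simp: differentiable_on_def)

lemma Ck_function_Suc_imp: "Ck_function (Suc k) f \<Longrightarrow> Ck_function k f"
proof (induction k arbitrary: f)
  case 0
  show ?case using Ck_function_continuous[OF 0] by simp
next
  case (Suc k)
  then show ?case by simp
qed

lemma Ck_function_const: "Ck_function k (\<lambda>x. c)"
proof (induction k arbitrary: c)
  case (Suc k)
  show ?case by (rule Ck_function_SucI[where f' = "\<lambda>x h. 0"]) (use Suc in auto)
qed auto

lemma Ck_function_nth: "Ck_function k (\<lambda>x::real ^ 'n. x $ i)"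
proof (cases k)
  case (Suc k)
  have "((\<lambda>x. x $ i) has_derivative (\<lambda>h. h $ i)) (at x)" for x :: "real ^ 'n"
    by (rule bounded_linear_imp_has_derivative) (rule bounded_linear_vec_nth)
  then show ?thesis
    unfolding Suc by (rule Ck_function_SucI) (rule Ck_function_const)
qed (auto intro!: continuous_intros)

lemma Ck_function_add:
  "Ck_function k f \<Longrightarrow> Ck_function k g \<Longrightarrow> Ck_function k (\<lambda>x. f x + g x)"
proof (induction k arbitrary: f g)
  case (Suc k)
  show ?case
    by (rule Ck_function_SucI[OF has_derivative_add])
      (use Suc Ck_function_SucD in blast)+
qed (auto intro!: continuous_intros)

lemma Ck_function_mult:
  "Ck_function k f \<Longrightarrow> Ck_function k g \<Longrightarrow> Ck_function k (\<lambda>x. f x * g x)"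
proof (induction k arbitrary: f g)
  case (Suc k)
  show ?case
  proof (rule Ck_function_SucI[OF has_derivative_mult])
    show "(f has_derivative frechet_derivative f (at x)) (at x)"
      "(g has_derivative frechet_derivative g (at x)) (at x)" for x
      using Suc.prems Ck_function_SucD by blast+
    show "Ck_function k (\<lambda>x. f x * frechet_derivative g (at x) (axis i 1) +
                            frechet_derivative f (at x) (axis i 1) * g x)" for i
      by (intro Ck_function_add Suc.IH Ck_function_SucD(2) Suc.prems Suc.prems[THEN Ck_function_Suc_imp])
  qed
qed (auto intro!: continuous_intros)

lemma Ck_function_sum:
  assumes "\<And>i. i \<in> I \<Longrightarrow> Ck_function k (f i)"
  shows "Ck_function k (\<lambda>x. \<Sum>i\<in>I. f i x)"
  using assms
  by (induction I rule: infinite_finite_induct)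
    (auto intro: Ck_function_const Ck_function_add)

lemma Ck_function_inverse:
  assumes "\<And>x. f x \<noteq> 0"
  shows "Ck_function k f \<Longrightarrow> Ck_function k (\<lambda>x. inverse (f x))"
proof (induction k)
  case (Suc k)
  let ?Df = "\<lambda>x. frechet_derivative f (at x)"
  show ?case
  proof (rule Ck_function_SucI)
    show "((\<lambda>x. inverse (f x)) has_derivative (\<lambda>h. - (inverse (f x) * ?Df x h * inverse (f x)))) (at x)" for x
      by (rule Deriv.has_derivative_inverse) (rule assms, rule Ck_function_SucD(1)[OF Suc.prems])
    have "Ck_function k (\<lambda>x. - 1 * (inverse (f x) * ?Df x (axis i 1) * inverse (f x)))" for i
      by (intro Ck_function_const Ck_function_mult Suc.IH Ck_function_SucD(2) Suc.prems Suc.prems[THEN Ck_function_Suc_imp])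
    then show "Ck_function k (\<lambda>x. - (inverse (f x) * ?Df x (axis i 1) * inverse (f x)))" for i
      by simp
  qed
qed (use assms in \<open>auto intro!: continuous_intros\<close>)

lemma Ck_function_scale:
  "Ck_function k f \<Longrightarrow> Ck_function k (\<lambda>x. f (c *\<^sub>R x))"
proof (induction k arbitrary: f)
  case 0
  then show ?case
    by (auto intro!: continuous_intros elim: continuous_on_compose2)
next
  case (Suc k)
  show ?case
  proof (rule Ck_function_SucI)
    show "((\<lambda>x. f (c *\<^sub>R x)) has_derivative
           (\<lambda>h. frechet_derivative f (at (c *\<^sub>R x)) (c *\<^sub>R h))) (at x)" for x
      by (rule has_derivative_compose[OF _ Ck_function_SucD(1)[OF Suc.prems]])
        (auto intro!: derivative_eq_intros)
    have "frechet_derivative f (at y) (c *\<^sub>R h) = c * frechet_derivative f (at y) h" for y h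
      using linear_scale[OF has_derivative_linear[OF Ck_function_SucD(1)[OF Suc.prems]]] by simp
    then show "Ck_function k (\<lambda>x. frechet_derivative f (at (c *\<^sub>R x)) (c *\<^sub>R axis i 1))" for i
      using Ck_function_mult[OF Ck_function_const Suc.IH[OF Ck_function_SucD(2)[OF Suc.prems]]]
      by simp
  qed
qed

lemma partial_deriv_scale:
  assumes "\<And>x. f differentiable (at x)"
  shows "partial_deriv i (\<lambda>x. a * f (c *\<^sub>R x)) = (\<lambda>x. a * c * partial_deriv i f (c *\<^sub>R x))"
proof
  fix x
  let ?D = "frechet_derivative f (at (c *\<^sub>R x))"
  have D: "(f has_derivative ?D) (at (c *\<^sub>R x))"
    using assms by (simp add: frechet_derivative_works)
  have "((\<lambda>x. a * f (c *\<^sub>R x)) has_derivative (\<lambda>h. a * ?D (c *\<^sub>R h))) (at x)"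
    by (rule has_derivative_mult_right,
        rule has_derivative_compose[where f = "\<lambda>x. c *\<^sub>R x" and g = f, OF _ D])
      (auto intro!: derivative_eq_intros)
  from partial_deriv_eq[OF this] show
    "partial_deriv i (\<lambda>x. a * f (c *\<^sub>R x)) x = a * c * partial_deriv i f (c *\<^sub>R x)"
    using linear_scale[OF has_derivative_linear[OF D]] by (simp add: partial_deriv_def)
qed

lemma laplacian_scale:
  assumes "Ck_function 2 f"
  shows "laplacian (\<lambda>x. f (c *\<^sub>R x)) x = c\<^sup>2 * laplacian f (c *\<^sub>R x)"
proof -
  have d: "f differentiable (at x)" "partial_deriv i f differentiable (at x)" for x i
    using assms by (auto simp: numeral_2_eq_2)
  have "partial_deriv i (partial_deriv i (\<lambda>x. f (c *\<^sub>R x))) x =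
      c\<^sup>2 * partial_deriv i (partial_deriv i f) (c *\<^sub>R x)" for i
    using partial_deriv_scale[of f i 1 c] partial_deriv_scale[of "partial_deriv i f" i c c] d
    by (simp add: power2_eq_square)
  then show ?thesis
    by (simp add: laplacian_def sum_distrib_left)
qed

lemma continuous_on_laplacian:
  assumes "Ck_function 2 f"
  shows "continuous_on UNIV (laplacian f)"
  using assms unfolding laplacian_def[abs_def]
  by (auto simp: numeral_2_eq_2 intro!: continuous_intros)

text \<open>Used to confine the Laplacian of a cutoff to the region where the cutoff is
  neither 0 nor 1, so that only the tail of the solution is seen by the diffusion term.\<close>

lemma partial_deriv_locally_const:
  assumes "open S" "x \<in> S" "\<And>y. y \<in> S \<Longrightarrow> f y = c"
  shows "partial_deriv i f x = 0"
proof -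
  have "(f has_derivative (\<lambda>h. 0)) (at x)"
    by (rule has_derivative_transform_within_open[OF has_derivative_const assms(1,2)])
      (simp add: assms(3))
  from partial_deriv_eq[OF this] show ?thesis .
qed

lemma laplacian_locally_const:
  assumes "open S" "x \<in> S" "\<And>y. y \<in> S \<Longrightarrow> f y = c"
  shows "laplacian f x = 0"
proof -
  have "partial_deriv i (partial_deriv i f) x = 0" for i
    by (rule partial_deriv_locally_const[OF assms(1,2)])
      (rule partial_deriv_locally_const[OF assms(1) _ assms(3)])
  then show ?thesis by (simp add: laplacian_def)
qed

section \<open>A smooth cutoff function\<close>

text \<open>The functions \<open>p (1 / x) * exp (- 1 / x)\<close>, extended by 0 to \<open>x \<le> 0\<close>.  Admitting every
  polynomial \<open>p\<close> makes the family closed under differentiation, so that smoothness follows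
  from one computation of a first derivative.\<close>

definition flat :: "real poly \<Rightarrow> real \<Rightarrow> real" where
  "flat p x = (if x > 0 then poly p (1 / x) * exp (- (1 / x)) else 0)"

lemma poly_times_exp_minus_tendsto_0:
  fixes p :: "real poly"
  shows "((\<lambda>x. poly p x * exp (- x)) \<longlongrightarrow> 0) at_top"
proof -
  have "((\<lambda>x. \<Sum>i\<le>degree p. coeff p i * (x ^ i / exp x)) \<longlongrightarrow> (\<Sum>i\<le>degree p. coeff p i * 0)) at_top"
    by (intro tendsto_intros tendsto_power_div_exp_0)
  then show ?thesis
    by (simp add: poly_altdef sum_distrib_right exp_minus divide_inverse mult.assoc)
qed

text \<open>Away from 0 this is the chain rule.  At 0 the difference quotient from the right is
  \<open>y * p y * exp (- y)\<close> at \<open>y = 1 / h\<close>, and the exponential wins over the polynomial.\<close>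

lemma flat_has_derivative:
  "(flat p has_real_derivative flat ([:0, 0, 1:] * (p - pderiv p)) x) (at x)"
proof -
  consider "x > 0" | "x < 0" | "x = 0" by linarith
  then show ?thesis
  proof cases
    case 1
    have "((\<lambda>x. poly p (1 / x) * exp (- (1 / x))) has_real_derivative
        flat ([:0, 0, 1:] * (p - pderiv p)) x) (at x)"
      using 1 by (auto intro!: derivative_eq_intros simp: flat_def field_simps power2_eq_square)
    then show ?thesis
      by (rule has_field_derivative_transform_within_open[where S = "{0<..}"])
        (use 1 in \<open>auto simp: flat_def\<close>)
  next
    case 2
    have "((\<lambda>x. 0) has_real_derivative flat ([:0, 0, 1:] * (p - pderiv p)) x) (at x)"
      using 2 by (auto simp: flat_def)
    then show ?thesis
      by (rule has_field_derivative_transform_within_open[where S = "{..<0}"])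
        (use 2 in \<open>auto simp: flat_def\<close>)
  next
    case 3
    \<comment> \<open>\<open>pCons 0 p\<close> supplies the factor \<open>1 / h\<close> of the difference quotient.\<close>
    have "((\<lambda>h. poly (pCons 0 p) (inverse h) * exp (- inverse h)) \<longlongrightarrow> 0) (at_right 0)"
      by (rule filterlim_compose[OF poly_times_exp_minus_tendsto_0 filterlim_inverse_at_top_right])
    moreover have "eventually (\<lambda>h. poly (pCons 0 p) (inverse h) * exp (- inverse h) = flat p h / h)
        (at_right (0::real))"
      using eventually_at_right_less[of "0::real"]
      by eventually_elim (simp add: flat_def field_simps)
    ultimately have "((\<lambda>h. flat p h / h) \<longlongrightarrow> 0) (at_right 0)"
      by (rule Lim_transform_eventually)
    moreover have "((\<lambda>h. flat p h / h) \<longlongrightarrow> 0) (at_left 0)"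
    proof (rule Lim_transform_eventually[OF tendsto_const])
      show "eventually (\<lambda>h. 0 = flat p h / h) (at_left (0::real))"
        unfolding eventually_at_filter by (auto simp: flat_def)
    qed
    ultimately have "((\<lambda>h. flat p h / h) \<longlongrightarrow> 0) (at 0)"
      by (intro filterlim_split_at)
    then show ?thesis
      using 3 by (simp add: DERIV_def flat_def)
  qed
qed

lemma Ck_function_flat_compose:
  assumes "Ck_function k g"
  shows "Ck_function k (\<lambda>x. flat p (g x))"
  using assms
proof (induction k arbitrary: p)
  case 0
  have "continuous_on UNIV (flat p)"
    using flat_has_derivative by (intro continuous_at_imp_continuous_on) (blast intro: DERIV_isCont)
  with 0 show ?case
    by (auto elim: continuous_on_compose2)
next
  case (Suc k)
  obtain q where q: "\<And>y. (flat p has_real_derivative flat q y) (at y)"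
    using flat_has_derivative by blast
  let ?Dg = "\<lambda>x. frechet_derivative g (at x)"
  show ?case
  proof (rule Ck_function_SucI)
    fix x
    show "((\<lambda>x. flat p (g x)) has_derivative (\<lambda>h. flat q (g x) * ?Dg x h)) (at x)"
      by (rule has_derivative_compose[where f = g and g = "flat p" and f' = "?Dg x"
            and g' = "\<lambda>h. flat q (g x) * h"])
        (rule Ck_function_SucD(1)[OF Suc.prems] has_field_derivative_imp_has_derivative[OF q])+
    show "Ck_function k (\<lambda>x. flat q (g x) * ?Dg x (axis i 1))" for i
      by (intro Ck_function_mult Suc.IH Ck_function_SucD(2) Suc.prems Suc.prems[THEN Ck_function_Suc_imp])
  qed
qed

text \<open>A smooth radial transition from 1 on the unit ball to 0 outside the ball of radius 2.
  It is a function of \<open>(norm x)\<^sup>2\<close> rather than \<open>norm x\<close> because only the former is smooth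
  at the origin.\<close>

definition bump :: "real ^ 'n \<Rightarrow> real" where
  "bump x = flat 1 (4 - (norm x)\<^sup>2) / (flat 1 (4 - (norm x)\<^sup>2) + flat 1 ((norm x)\<^sup>2 - 1))"

lemma flat_1_nonneg: "flat 1 x \<ge> 0"
  by (simp add: flat_def)

text \<open>Since \<open>1 < 4\<close>, at least one of the two arguments is positive.\<close>

lemma bump_denominator_pos: "flat 1 (4 - r) + flat 1 (r - 1) > 0"
  by (auto simp: flat_def add_pos_nonneg add_nonneg_pos)

lemma bump_range: "0 \<le> bump x" "bump x \<le> 1"
  using bump_denominator_pos[of "(norm x)\<^sup>2"]
  by (auto simp: bump_def flat_1_nonneg intro!: divide_nonneg_pos)

lemma bump_eq_1: 
  assumes "norm x \<le> 1"
  shows "bump x = 1"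
proof -
  have "(norm x)\<^sup>2 \<le> 1" using assms by (simp add: power_le_one)
  then have "flat 1 ((norm x)\<^sup>2 - 1) = 0" by (simp add: flat_def)
  with bump_denominator_pos[of "(norm x)\<^sup>2"] show ?thesis
    by (simp add: bump_def)
qed

lemma bump_eq_0: 
  assumes "norm x \<ge> 2"
  shows "bump x = 0"
proof -
  have "2\<^sup>2 \<le> (norm x)\<^sup>2" using assms by (intro power_mono) auto
  then show ?thesis by (simp add: bump_def flat_def)
qed

lemma Ck_function_bump: "Ck_function k bump"
proof -
  have n: "Ck_function k (\<lambda>x::real^'n. (norm x)\<^sup>2)"
    unfolding power2_norm_eq_inner inner_vec_def inner_real_def
    by (intro Ck_function_sum Ck_function_mult Ck_function_nth)
  have P: "Ck_function k (\<lambda>x::real^'n. flat 1 (4 + - 1 * (norm x)\<^sup>2))"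
    and Q: "Ck_function k (\<lambda>x::real^'n. flat 1 ((norm x)\<^sup>2 + - 1))"
    by (intro Ck_function_flat_compose Ck_function_add Ck_function_mult Ck_function_const n)+
  have "Ck_function k (\<lambda>x::real^'n. flat 1 (4 + - 1 * (norm x)\<^sup>2) *
      inverse (flat 1 (4 + - 1 * (norm x)\<^sup>2) + flat 1 ((norm x)\<^sup>2 + - 1)))"
    using bump_denominator_pos
    by (intro Ck_function_mult Ck_function_inverse Ck_function_add P Q) (simp add: less_imp_neq[symmetric])
  then show ?thesis
    by (simp add: bump_def[abs_def] divide_inverse)
qed

lemma test_function_scaled_bump:
  assumes "R > 0"
  shows "test_function (\<lambda>x. bump (x /\<^sub>R R))"
proof -
  have "{x::real^'n. bump (x /\<^sub>R R) \<noteq> 0} \<subseteq> cball 0 (2 * R)"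
  proof
    fix x :: "real^'n" assume "x \<in> {x. bump (x /\<^sub>R R) \<noteq> 0}"
    then have "norm (x /\<^sub>R R) < 2" using bump_eq_0 not_le by blast
    then show "x \<in> cball 0 (2 * R)" using assms by (simp add: field_simps)
  qed
  then have "bounded {x::real^'n. bump (x /\<^sub>R R) \<noteq> 0}"
    using bounded_cball bounded_subset by blast
  then show ?thesis
    unfolding test_function_def
    using Ck_function_scale[OF Ck_function_bump] by (simp only: compact_closure) blast
qed

lemma laplacian_bump_bounded:
  obtains K where "K > 0" "\<And>x::real^'n. \<bar>laplacian bump x\<bar> \<le> K"
proof -
  have "compact (laplacian bump ` cball (0::real^'n) 2)"
    by (rule compact_continuous_image)
      (auto intro: continuous_on_subset[OF continuous_on_laplacian[OF Ck_function_bump]])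
  then obtain K where K: "K > 0" "\<And>x::real^'n. x \<in> cball 0 2 \<Longrightarrow> \<bar>laplacian bump x\<bar> \<le> K"
    using compact_imp_bounded bounded_pos[of "laplacian bump ` cball (0::real^'n) 2"] by auto
  have "laplacian bump x = 0" if "x \<notin> cball 0 2" for x :: "real^'n"
    by (rule laplacian_locally_const[of "- cball 0 2" _ _ 0])
      (use that in \<open>auto simp: bump_eq_0\<close>)
  with K show ?thesis by (metis abs_zero less_imp_le that)
qed

text \<open>The factor \<open>1 / R\<^sup>2\<close> comes from the scaling of the Laplacian.  It is supported in an
  annulus because the cutoff is constant on both sides of it.\<close>

lemma laplacian_scaled_bump:
  assumes "R > 0" and K: "\<And>x::real^'n. \<bar>laplacian bump x\<bar> \<le> K"
  shows "\<bar>laplacian (\<lambda>x::real^'n. bump (x /\<^sub>R R)) x\<bar> \<le>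
    K / R\<^sup>2 * indicator {x. R \<le> norm x \<and> norm x \<le> 2 * R} x"
proof (cases "R \<le> norm x \<and> norm x \<le> 2 * R")
  case True
  then show ?thesis
    using K[of "x /\<^sub>R R"] assms(1)
    by (simp add: laplacian_scale Ck_function_bump abs_mult field_simps)
next
  case False
  let ?y = "x /\<^sub>R R"
  have "norm ?y < 1 \<or> norm ?y > 2"
    using False assms(1) by (auto simp: field_simps)
  then have "laplacian bump ?y = 0"
  proof
    assume "norm ?y < 1"
    then show ?thesis
      by (intro laplacian_locally_const[of "ball 0 1" _ _ 1]) (auto simp: bump_eq_1)
  next
    assume "norm ?y > 2"
    then show ?thesis
      by (intro laplacian_locally_const[of "- cball 0 2" _ _ 0]) (auto simp: bump_eq_0)
  qed
  with False show ?thesis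
    by (simp add: laplacian_scale Ck_function_bump)
qed

section \<open>The diffusion term tested with a cutoff\<close>

text \<open>The threshold \<open>s\<close> separates the two cases: below it \<open>a powr m\<close> is at most \<open>s powr m\<close>, and
  above it \<open>a powr (m - 1)\<close> is at most \<open>s powr (m - 1)\<close>.  Integrated over a set of volume
  \<open>V\<close> with a suitable \<open>s\<close>, this does the work of Hoelder's inequality
  $\int |v|^m \le V^{1-m} (\int |v|)^m$.\<close>

lemma powr_le_affine:
  fixes a s m :: real
  assumes "0 < m" "m < 1" "s > 0" "a \<ge> 0"
  shows "a powr m \<le> s powr (m - 1) * a + s powr m"
proof (cases "a \<le> s")
  case True
  then have "a powr m \<le> s powr m"
    using assms by (intro powr_mono2) auto
  also have "\<dots> \<le> s powr (m - 1) * a + s powr m"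
    using assms by simp
  finally show ?thesis .
next
  case False
  then have "a powr m = a powr (m - 1) * a"
    using assms by (simp add: powr_diff)
  also have "\<dots> \<le> s powr (m - 1) * a"
    using False assms by (intro mult_right_mono powr_mono2') auto
  also have "\<dots> \<le> s powr (m - 1) * a + s powr m"
    by simp
  finally show ?thesis .
qed

lemma abs_\<Phi>: "\<bar>\<Phi> m r\<bar> = \<bar>r\<bar> powr m"
  by (cases "r = 0") (simp_all add: \<Phi>_def abs_mult powr_diff)

text \<open>This is where the condition on the exponent \<open>m\<close> is decisive.  With the threshold
  \<open>s = e * R powr (- d)\<close> the coefficient of \<open>\<bar>r\<bar>\<close> is
  \<open>e powr (m - 1) * R powr (d * (1 - m) - 2)\<close>, which stays bounded as \<open>R\<close> grows exactly if
  \<open>d * (1 - m) \<le> 2\<close>; the constant term decays like the inverse volume of a ball of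
  radius \<open>R\<close>.\<close>

lemma abs_\<Phi>_le_critical_scaling:
  fixes m R e d r :: real
  assumes m: "0 < m" "m < 1" "d - 2 \<le> d * m" and "R \<ge> 1" "e > 0"
  shows "\<bar>\<Phi> m r\<bar> / R\<^sup>2 \<le> e powr (m - 1) * \<bar>r\<bar> + e powr m * R powr (- d)"
proof -
  define s where "s = e * R powr (- d)"
  have "s > 0" using assms by (simp add: s_def)
  have R2: "R powr x / R\<^sup>2 = R powr (x - 2)" for x
    using assms by (simp add: powr_diff)
  have "s powr (m - 1) / R\<^sup>2 = e powr (m - 1) * R powr (d - d * m - 2)"
    using assms by (simp add: s_def powr_mult powr_powr R2 algebra_simps flip: times_divide_eq_right)
  also have "\<dots> \<le> e powr (m - 1) * 1"
    using assms powr_mono[of "d - d * m - 2" 0 R] by (intro mult_left_mono) auto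
  finally have 1: "s powr (m - 1) / R\<^sup>2 \<le> e powr (m - 1)" by simp
  have "s powr m / R\<^sup>2 = e powr m * R powr (- d * m - 2)"
    using assms by (simp add: s_def powr_mult powr_powr R2 flip: times_divide_eq_right)
  also have "\<dots> \<le> e powr m * R powr (- d)"
    using assms by (intro mult_left_mono powr_mono) auto
  finally have 2: "s powr m / R\<^sup>2 \<le> e powr m * R powr (- d)" .
  have "\<bar>\<Phi> m r\<bar> / R\<^sup>2 \<le> (s powr (m - 1) * \<bar>r\<bar> + s powr m) / R\<^sup>2"
    using powr_le_affine[OF m(1,2) \<open>s > 0\<close>, of "\<bar>r\<bar>"] by (simp add: abs_\<Phi> divide_right_mono)
  also have "\<dots> = s powr (m - 1) / R\<^sup>2 * \<bar>r\<bar> + s powr m / R\<^sup>2"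
    by (simp add: add_divide_distrib)
  also have "\<dots> \<le> e powr (m - 1) * \<bar>r\<bar> + e powr m * R powr (- d)"
    by (intro add_mono mult_right_mono 1 2) auto
  finally show ?thesis .
qed

text \<open>If \<open>f\<close> fails to be integrable, its integral is 0 by convention, so the bound still holds.
  The diffusion term is thus controlled, in space and in time, by integrable majorants alone.\<close>

lemma abs_lebesgue_integral_le:
  fixes f g :: "'a \<Rightarrow> real"
  assumes "integrable M g" "\<And>x. \<bar>f x\<bar> \<le> g x"
  shows "\<bar>integral\<^sup>L M f\<bar> \<le> integral\<^sup>L M g"
proof (cases "integrable M f")
  case True
  have "\<bar>integral\<^sup>L M f\<bar> \<le> (LINT x|M. \<bar>f x\<bar>)"
    by (rule integral_abs_bound)
  also have "\<dots> \<le> integral\<^sup>L M g"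
    using True assms by (intro integral_mono) auto
  finally show ?thesis .
next
  case False
  have "0 \<le> g x" for x
    using assms(2)[of x] by linarith
  then have "0 \<le> integral\<^sup>L M g" by simp
  with False show ?thesis by (simp add: not_integrable_integral_eq)
qed

lemma sets_lebesgue_norm_ge: "{x::'a::euclidean_space. R \<le> norm x} \<in> sets lebesgue"
proof -
  have "{x::'a. R \<le> norm x} = - ball 0 R" by auto
  then show ?thesis by simp
qed

lemma integrable_indicator_abs:
  fixes v :: "'a \<Rightarrow> real"
  assumes "A \<in> sets M" "integrable M v"
  shows "integrable M (\<lambda>x. indicator A x * \<bar>v x\<bar>)"
  using integrable_mult_indicator[OF assms(1) integrable_abs[OF assms(2)]] by simp

lemma L1_norm_alt: "L1_norm A v = (LINT x|lebesgue. indicator A x * \<bar>v x\<bar>)"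
  by (simp add: L1_norm_def set_lebesgue_integral_def)

text \<open>The parameter \<open>e\<close> trades the two contributions against each other: the first one vanishes
  as \<open>R\<close> grows with \<open>e\<close> fixed, the second one is independent of \<open>R\<close> but small with \<open>e\<close>.
  In the critical case \<open>m = (N - 2) / N\<close>, with \<open>N = CARD('n)\<close>, no power of \<open>R\<close> is left over, and smallness comes
  from the tail of \<open>v\<close> alone.\<close>

lemma diffusion_term_bound:
  fixes v :: "real ^ 'n \<Rightarrow> real"
  assumes m: "0 < m" "m < 1" "real CARD('n) - 2 \<le> real CARD('n) * m"
    and R: "R \<ge> 1" and e: "e > 0"
    and K: "\<And>x::real^'n. \<bar>laplacian bump x\<bar> \<le> K"
    and v: "integrable lebesgue v"
  shows "\<bar>LINT x|lebesgue. \<Phi> m (v x) * laplacian (\<lambda>x. bump (x /\<^sub>R R)) x\<bar> \<le>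
    K * (e powr (m - 1) * L1_norm {x. R \<le> norm x} v +
         unit_ball_vol CARD('n) * 2 ^ CARD('n) * e powr m)"
proof -
  let ?A = "{x::real^'n. R \<le> norm x}" and ?B = "cball (0::real^'n) (2 * R)"
  let ?N = "CARD('n)"
  have K0: "K \<ge> 0" using K[of 0] by linarith
  define g where "g x = K * (e powr (m - 1) * (indicator ?A x * \<bar>v x\<bar>) +
    e powr m * R powr (- real ?N) * indicator ?B x)" for x
  have i1: "integrable lebesgue (\<lambda>x. indicator ?A x * \<bar>v x\<bar>)"
    using sets_lebesgue_norm_ge v by (rule integrable_indicator_abs)
  have i2: "integrable lebesgue (indicator ?B :: _ \<Rightarrow> real)"
    using lmeasurable_cball by (simp add: lmeasurable_iff_integrable)
  have bound: "\<bar>\<Phi> m (v x) * laplacian (\<lambda>x. bump (x /\<^sub>R R)) x\<bar> \<le> g x" for x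
  proof -
    let ?I = "indicator {x. R \<le> norm x \<and> norm x \<le> 2 * R} x :: real"
    have "\<bar>\<Phi> m (v x) * laplacian (\<lambda>x. bump (x /\<^sub>R R)) x\<bar> \<le> \<bar>\<Phi> m (v x)\<bar> * (K / R\<^sup>2 * ?I)"
      unfolding abs_mult using R K by (intro mult_left_mono laplacian_scaled_bump) auto
    also have "\<dots> = K * (\<bar>\<Phi> m (v x)\<bar> / R\<^sup>2) * ?I" by simp
    also have "\<dots> \<le> K * (e powr (m - 1) * \<bar>v x\<bar> + e powr m * R powr (- real ?N)) * ?I"
      using abs_\<Phi>_le_critical_scaling[OF m R e] K0
      by (intro mult_right_mono mult_left_mono) auto
    also have "\<dots> \<le> g x"
      using K0 by (auto simp: g_def indicator_def)
    finally show ?thesis .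
  qed
  have "\<bar>LINT x|lebesgue. \<Phi> m (v x) * laplacian (\<lambda>x. bump (x /\<^sub>R R)) x\<bar> \<le> integral\<^sup>L lebesgue g"
    by (rule abs_lebesgue_integral_le[OF _ bound]) (use i1 i2 in \<open>simp add: g_def[abs_def]\<close>)
  also have "\<dots> = K * (e powr (m - 1) * L1_norm ?A v + e powr m * R powr (- real ?N) * measure lebesgue ?B)"
    using i1 i2 by (simp add: g_def[abs_def] L1_norm_alt)
  also have "measure lebesgue ?B = unit_ball_vol ?N * 2 ^ ?N * R powr (real ?N)"
    using R by (simp add: content_cball power_mult_distrib powr_realpow)
  also have "e powr m * R powr (- real ?N) * (unit_ball_vol ?N * 2 ^ ?N * R powr (real ?N)) =
      unit_ball_vol ?N * 2 ^ ?N * e powr m"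
    using R by (simp add: powr_minus)
  finally show ?thesis .
qed

section \<open>Tails and continuity in $L^1$\<close>

text \<open>The radii \<open>Suc n\<close>, here and below, keep the scale of the cutoff at least 1.\<close>

lemma L1_norm_tail_tendsto_0:
  fixes v :: "real ^ 'n \<Rightarrow> real"
  assumes "integrable lebesgue v"
  shows "(\<lambda>n. L1_norm {x. real (Suc n) \<le> norm x} v) \<longlonglongrightarrow> 0"
proof -
  have "(\<lambda>n. LINT x|lebesgue. indicator {x. real (Suc n) \<le> norm x} x * \<bar>v x\<bar>)
      \<longlonglongrightarrow> (LINT x|(lebesgue :: (real^'n) measure). 0)"
  proof (rule integral_dominated_convergence[where w = "\<lambda>x. \<bar>v x\<bar>"])
    show "AE x in lebesgue. (\<lambda>n. indicator {x. real (Suc n) \<le> norm x} x * \<bar>v x\<bar>) \<longlonglongrightarrow> 0"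
    proof (rule AE_I2, rule tendsto_eventually)
      fix x :: "real^'n"
      obtain k :: nat where k: "norm x < real k" using reals_Archimedean2 by blast
      show "\<forall>\<^sub>F n in sequentially. indicator {x. real (Suc n) \<le> norm x} x * \<bar>v x\<bar> = 0"
        using eventually_ge_at_top[of k] by eventually_elim (use k in auto)
    qed
    show "(\<lambda>x. indicator {x. real (Suc n) \<le> norm x} x * \<bar>v x\<bar>) \<in> borel_measurable lebesgue" for n
      using integrable_indicator_abs[OF sets_lebesgue_norm_ge assms] by blast
  qed (use assms in \<open>auto simp: indicator_def\<close>)
  then show ?thesis by (simp add: L1_norm_alt)
qed

lemma L1_norm_mono:
  assumes "A \<in> sets lebesgue" "integrable lebesgue v"
  shows "L1_norm A v \<le> L1_norm UNIV v"
  unfolding L1_norm_alt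
  by (rule integral_mono)
    (use assms integrable_indicator_abs[of _ lebesgue v] in \<open>auto simp: indicator_def\<close>)

lemma L1_norm_nonneg: "0 \<le> L1_norm A v"
  by (simp add: L1_norm_alt)

lemma abs_L1_norm_diff_le:
  assumes A: "A \<in> sets lebesgue" and f: "integrable lebesgue f" and g: "integrable lebesgue g"
  shows "\<bar>L1_norm A f - L1_norm A g\<bar> \<le> L1_norm UNIV (\<lambda>x. f x - g x)"
proof -
  have "L1_norm A f - L1_norm A g = (LINT x|lebesgue. indicator A x * \<bar>f x\<bar> - indicator A x * \<bar>g x\<bar>)"
    using assms unfolding L1_norm_alt by (intro Bochner_Integration.integral_diff[symmetric] integrable_indicator_abs)
  also have "\<bar>\<dots>\<bar> \<le> (LINT x|lebesgue. indicator UNIV x * \<bar>f x - g x\<bar>)"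
    using f g by (intro abs_lebesgue_integral_le) (auto simp: indicator_def)
  finally show ?thesis by (simp add: L1_norm_alt)
qed

lemma continuous_L1_imp_integrable:
  "continuous_L1 I UNIV u \<Longrightarrow> t \<in> I \<Longrightarrow> integrable lebesgue (u t)"
  by (simp add: continuous_L1_def set_integrable_def)

text \<open>Applied to the total mass, which must be known to be continuous in time, and to the norm
  of a tail, which must be measurable and locally bounded in time for dominated convergence.\<close>

lemma continuous_on_L1_contraction:
  fixes J :: "(real ^ 'n \<Rightarrow> real) \<Rightarrow> real"
  assumes u: "continuous_L1 I UNIV u"
    and J: "\<And>f g. integrable lebesgue f \<Longrightarrow> integrable lebesgue g \<Longrightarrow>
      \<bar>J f - J g\<bar> \<le> L1_norm UNIV (\<lambda>x. f x - g x)"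
  shows "continuous_on I (\<lambda>t. J (u t))"
  unfolding continuous_on
proof
  fix t assume t: "t \<in> I"
  have "((\<lambda>s. J (u s) - J (u t)) \<longlongrightarrow> 0) (at t within I)"
  proof (rule tendsto_rabs_zero_cancel, rule tendsto_sandwich[OF _ _ tendsto_const])
    show "((\<lambda>s. L1_norm UNIV (\<lambda>x. u s x - u t x)) \<longlongrightarrow> 0) (at t within I)"
      using u t by (simp add: continuous_L1_def)
    show "\<forall>\<^sub>F s in at t within I. \<bar>J (u s) - J (u t)\<bar> \<le> L1_norm UNIV (\<lambda>x. u s x - u t x)"
      unfolding eventually_at_filter
      using continuous_L1_imp_integrable[OF u] t by (auto intro!: J eventuallyI)
  qed auto
  then show "((\<lambda>s. J (u s)) \<longlongrightarrow> J (u t)) (at t within I)"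
    by (simp add: LIM_zero_iff)
qed

lemma abs_integral_diff_le_L1_norm:
  assumes "integrable lebesgue f" "integrable lebesgue g"
  shows "\<bar>integral\<^sup>L lebesgue f - integral\<^sup>L lebesgue g\<bar> \<le> L1_norm UNIV (\<lambda>x. f x - g x)"
  using assms integral_abs_bound[of lebesgue "\<lambda>x. f x - g x"] by (simp add: L1_norm_alt)

section \<open>Passage to the limit\<close>

lemma set_integrable_reflect_kernel:
  fixes l :: "real \<Rightarrow> real"
  assumes "set_integrable lebesgue {0..t} l"
  shows "set_integrable lebesgue {0..t} (\<lambda>\<tau>. l (t - \<tau>))"
proof -
  have "integrable lebesgue (\<lambda>\<tau>. indicator {0..t} (t + (-1) * \<tau>) *\<^sub>R l (t + (-1) * \<tau>))"
    using assms unfolding set_integrable_def by (rule lebesgue_integrable_real_affine) simp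
  moreover have "indicator {0..t} (t + (-1) * \<tau>) = (indicator {0..t} \<tau> :: real)" for \<tau>
    by (auto simp: indicator_def)
  ultimately show ?thesis by (simp add: set_integrable_def)
qed

text \<open>Dominated convergence is applied to the majorants \<open>A n\<close> only, as nothing is known about
  the measurability of \<open>F n\<close>.  The constant \<open>a\<close> may blow up as \<open>\<delta>\<close> tends to 0; this is harmless
  because \<open>\<delta>\<close> is fixed before \<open>n\<close> tends to infinity.\<close>

lemma time_conv_tendsto_0:
  fixes F A :: "nat \<Rightarrow> real \<Rightarrow> real"
  assumes l: "set_integrable lebesgue {0..t} l"
    and A_cont: "\<And>n. continuous_on {0..t} (A n)"
    and A_bound: "\<And>n \<tau>. \<tau> \<in> {0..t} \<Longrightarrow> \<bar>A n \<tau>\<bar> \<le> C"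
    and A_lim: "\<And>\<tau>. \<tau> \<in> {0..t} \<Longrightarrow> (\<lambda>n. A n \<tau>) \<longlonglongrightarrow> 0"
    and F: "\<And>\<delta>. \<delta> > 0 \<Longrightarrow> \<exists>a. \<forall>n. \<forall>\<tau>\<in>{0..t}. \<bar>F n \<tau>\<bar> \<le> a * A n \<tau> + \<delta>"
  shows "(\<lambda>n. time_conv l (F n) t) \<longlonglongrightarrow> 0"
proof -
  define w where "w \<tau> = indicator {0..t} \<tau> * \<bar>l (t - \<tau>)\<bar>" for \<tau>
  have w: "integrable lebesgue w"
    using integrable_abs[OF set_integrable_reflect_kernel[OF l, unfolded set_integrable_def]]
    by (simp add: w_def[abs_def] abs_mult)
  have w0: "w \<tau> \<ge> 0" for \<tau> by (simp add: w_def)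
  have wA_meas: "(\<lambda>\<tau>. w \<tau> * A n \<tau>) \<in> borel_measurable lebesgue" for n
  proof -
    have "(\<lambda>\<tau>. indicator {0..t} \<tau> *\<^sub>R A n \<tau>) \<in> borel_measurable borel"
      by (intro borel_measurable_continuous_on_indicator A_cont) auto
    then have "(\<lambda>\<tau>. indicator {0..t} \<tau> *\<^sub>R A n \<tau>) \<in> borel_measurable lebesgue"
      by (intro measurable_completion) simp
    then have "(\<lambda>\<tau>. w \<tau> * (indicator {0..t} \<tau> *\<^sub>R A n \<tau>)) \<in> borel_measurable lebesgue"
      using w by (intro borel_measurable_times) auto
    moreover have "w \<tau> * (indicator {0..t} \<tau> *\<^sub>R A n \<tau>) = w \<tau> * A n \<tau>" for \<tau>
      by (simp add: w_def indicator_def)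
    ultimately show ?thesis by (simp only:)
  qed
  have wA_bound: "\<bar>w \<tau> * A n \<tau>\<bar> \<le> w \<tau> * C" for n \<tau>
    using A_bound[of \<tau> n] by (auto simp: w_def indicator_def abs_mult intro: mult_left_mono)
  have wA: "integrable lebesgue (\<lambda>\<tau>. w \<tau> * A n \<tau>)" for n
    by (rule Bochner_Integration.integrable_bound[OF integrable_mult_left[OF w, of C] wA_meas])
      (auto intro!: AE_I2 order_trans[OF wA_bound])
  have "(\<lambda>n. LINT \<tau>|lebesgue. w \<tau> * A n \<tau>) \<longlonglongrightarrow> (LINT \<tau>|(lebesgue :: real measure). 0)"
  proof (rule integral_dominated_convergence[OF _ wA_meas integrable_mult_left[OF w, of C]])
    show "AE \<tau> in lebesgue. (\<lambda>n. w \<tau> * A n \<tau>) \<longlonglongrightarrow> 0"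
    proof (rule AE_I2)
      fix \<tau> :: real
      show "(\<lambda>n. w \<tau> * A n \<tau>) \<longlonglongrightarrow> 0"
        by (cases "\<tau> \<in> {0..t}") (auto simp: w_def intro!: tendsto_mult_right_zero A_lim)
    qed
  qed (use wA_bound in auto)
  then have lim: "(\<lambda>n. LINT \<tau>|lebesgue. w \<tau> * A n \<tau>) \<longlonglongrightarrow> 0" by simp
  define W where "W = integral\<^sup>L lebesgue w"
  have "W \<ge> 0" using w0 by (simp add: W_def)
  show ?thesis
  proof (rule LIMSEQ_I)
    fix e :: real assume "e > 0"
    \<comment> \<open>The summand 1 covers the case \<open>W = 0\<close>.\<close>
    define \<delta> where "\<delta> = e / (2 * (W + 1))"
    have "\<delta> > 0" using \<open>e > 0\<close> \<open>W \<ge> 0\<close> by (simp add: \<delta>_def)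
    have "W * \<delta> < e / 2 * 1"
      using \<open>e > 0\<close> \<open>W \<ge> 0\<close> by (simp add: \<delta>_def field_simps)
    obtain a where a: "\<And>n \<tau>. \<tau> \<in> {0..t} \<Longrightarrow> \<bar>F n \<tau>\<bar> \<le> a * A n \<tau> + \<delta>"
      using F[OF \<open>\<delta> > 0\<close>] by blast
    have bound: "\<bar>time_conv l (F n) t\<bar> \<le> a * (LINT \<tau>|lebesgue. w \<tau> * A n \<tau>) + W * \<delta>" for n
    proof -
      have "\<bar>time_conv l (F n) t\<bar> \<le> (LINT \<tau>|lebesgue. a * (w \<tau> * A n \<tau>) + w \<tau> * \<delta>)"
        unfolding time_conv_def set_lebesgue_integral_def
      proof (rule abs_lebesgue_integral_le)
        show "integrable lebesgue (\<lambda>\<tau>. a * (w \<tau> * A n \<tau>) + w \<tau> * \<delta>)"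
          using wA w by simp
        fix \<tau>
        show "\<bar>indicator {0..t} \<tau> *\<^sub>R (l (t - \<tau>) * F n \<tau>)\<bar> \<le> a * (w \<tau> * A n \<tau>) + w \<tau> * \<delta>"
        proof (cases "\<tau> \<in> {0..t}")
          case True
          have "\<bar>l (t - \<tau>)\<bar> * \<bar>F n \<tau>\<bar> \<le> \<bar>l (t - \<tau>)\<bar> * (a * A n \<tau> + \<delta>)"
            using a[OF True] by (intro mult_left_mono) auto
          then show ?thesis using True by (simp add: w_def abs_mult algebra_simps)
        qed (simp add: w_def)
      qed
      also have "\<dots> = a * (LINT \<tau>|lebesgue. w \<tau> * A n \<tau>) + W * \<delta>"
        using wA w by (simp add: W_def)
      finally show ?thesis .
    qed
    have "(\<lambda>n. a * (LINT \<tau>|lebesgue. w \<tau> * A n \<tau>)) \<longlonglongrightarrow> 0"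
      using tendsto_mult_right_zero[OF lim] .
    then have "\<forall>\<^sub>F n in sequentially. a * (LINT \<tau>|lebesgue. w \<tau> * A n \<tau>) < e / 2"
      using \<open>e > 0\<close> by (intro order_tendstoD(2)) auto
    then have "\<forall>\<^sub>F n in sequentially. norm (time_conv l (F n) t - 0) < e"
    proof eventually_elim
      case (elim n)
      then show ?case using bound[of n] \<open>W * \<delta> < e / 2 * 1\<close> by simp
    qed
    then show "\<exists>N. \<forall>n\<ge>N. norm (time_conv l (F n) t - 0) < e"
      by (simp add: eventually_sequentially)
  qed
qed

lemma integral_times_scaled_bump_tendsto:
  fixes f :: "real ^ 'n \<Rightarrow> real"
  assumes f: "integrable lebesgue f"
  shows "(\<lambda>n. LINT x|lebesgue. f x * bump (x /\<^sub>R real (Suc n))) \<longlonglongrightarrow> integral\<^sup>L lebesgue f"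
proof (rule integral_dominated_convergence[where w = "\<lambda>x. \<bar>f x\<bar>"])
  show "(\<lambda>x. f x * bump (x /\<^sub>R real (Suc n))) \<in> borel_measurable lebesgue" for n
  proof -
    have "(\<lambda>x::real^'n. bump (x /\<^sub>R real (Suc n))) \<in> borel_measurable borel"
      using Ck_function_continuous[OF Ck_function_scale[OF Ck_function_bump]]
      by (rule borel_measurable_continuous_onI)
    then have "(\<lambda>x::real^'n. bump (x /\<^sub>R real (Suc n))) \<in> borel_measurable lebesgue"
      by (intro measurable_completion) simp
    with f show ?thesis by (intro borel_measurable_times) auto
  qed
  show "AE x in lebesgue. (\<lambda>n. f x * bump (x /\<^sub>R real (Suc n))) \<longlonglongrightarrow> f x"
  proof (rule AE_I2, rule tendsto_eventually)
    fix x :: "real^'n"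
    obtain k :: nat where k: "norm x < real k" using reals_Archimedean2 by blast
    show "\<forall>\<^sub>F n in sequentially. f x * bump (x /\<^sub>R real (Suc n)) = f x"
      using eventually_ge_at_top[of k]
    proof eventually_elim
      case (elim n)
      then have "norm (x /\<^sub>R real (Suc n)) \<le> 1" using k by (simp add: field_simps)
      then show ?case by (simp only: bump_eq_1 mult_1_right)
    qed
  qed
  show "AE x in lebesgue. norm (f x * bump (x /\<^sub>R real (Suc n))) \<le> \<bar>f x\<bar>" for n
    by (intro AE_I2) (simp add: abs_mult bump_range mult_left_le)
qed (use f in auto)

text \<open>The majorants are the norms of the tails of \<open>u \<tau>\<close>: they are continuous in \<open>\<tau>\<close>, bounded on
  the compact interval \<open>{0..t}\<close>, and tend to 0 for each \<open>\<tau>\<close>.\<close>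

lemma time_conv_diffusion_term_tendsto_0:
  fixes u :: "real \<Rightarrow> real ^ 'n \<Rightarrow> real"
  assumes m: "0 < m" "m < 1" "real CARD('n) - 2 \<le> real CARD('n) * m"
    and l: "set_integrable lebesgue {0..t} l"
    and u: "continuous_L1 {0..} UNIV u"
  shows "(\<lambda>n. time_conv l (\<lambda>\<tau>. LINT x|lebesgue. \<Phi> m (u \<tau> x) *
    laplacian (\<lambda>x. bump (x /\<^sub>R real (Suc n))) x) t) \<longlonglongrightarrow> 0"
proof -
  define A where "A n \<tau> = L1_norm {x. real (Suc n) \<le> norm x} (u \<tau>)" for n \<tau>
  have ui: "integrable lebesgue (u \<tau>)" if "\<tau> \<in> {0..t}" for \<tau>
    using continuous_L1_imp_integrable[OF u] that by simp
  have cont: "continuous_on {0..t} (\<lambda>\<tau>. L1_norm B (u \<tau>))" if "B \<in> sets lebesgue" for B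
    by (rule continuous_on_subset[OF continuous_on_L1_contraction[OF u abs_L1_norm_diff_le[OF that]]]) auto
  have "compact ((\<lambda>\<tau>. L1_norm UNIV (u \<tau>)) ` {0..t})"
    by (intro compact_continuous_image cont) auto
  then have "bounded ((\<lambda>\<tau>. L1_norm UNIV (u \<tau>)) ` {0..t})"
    by (rule compact_imp_bounded)
  then obtain C where C: "\<And>\<tau>. \<tau> \<in> {0..t} \<Longrightarrow> \<bar>L1_norm UNIV (u \<tau>)\<bar> \<le> C"
    unfolding bounded_iff real_norm_def by blast
  obtain K where K: "K > 0" "\<And>x::real^'n. \<bar>laplacian bump x\<bar> \<le> K"
    using laplacian_bump_bounded by blast
  define c where "c = K * (unit_ball_vol CARD('n) * 2 ^ CARD('n))"
  have "c > 0" using K by (simp add: c_def)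
  show ?thesis
  proof (rule time_conv_tendsto_0[OF l, of A C])
    show "continuous_on {0..t} (A n)" for n
      unfolding A_def by (rule cont[OF sets_lebesgue_norm_ge])
    show "\<bar>A n \<tau>\<bar> \<le> C" if "\<tau> \<in> {0..t}" for n \<tau>
      using L1_norm_mono[OF sets_lebesgue_norm_ge ui[OF that], of "real (Suc n)"]
        L1_norm_nonneg[of _ "u \<tau>"] C[OF that]
      by (simp add: A_def)
    show "(\<lambda>n. A n \<tau>) \<longlonglongrightarrow> 0" if "\<tau> \<in> {0..t}" for \<tau>
      unfolding A_def by (rule L1_norm_tail_tendsto_0[OF ui[OF that]])
    fix \<delta> :: real assume "\<delta> > 0"
    \<comment> \<open>Chosen to make the part of the bound that does not depend on \<open>n\<close> equal to \<open>\<delta>\<close>.\<close>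
    define e where "e = (\<delta> / c) powr (1 / m)"
    have "e > 0" using \<open>\<delta> > 0\<close> \<open>c > 0\<close> by (simp add: e_def)
    have "c * e powr m = \<delta>"
      using m \<open>\<delta> > 0\<close> \<open>c > 0\<close> by (simp add: e_def powr_powr)
    then have "\<bar>LINT x|lebesgue. \<Phi> m (u \<tau> x) * laplacian (\<lambda>x. bump (x /\<^sub>R real (Suc n))) x\<bar>
        \<le> (K * e powr (m - 1)) * A n \<tau> + \<delta>" if "\<tau> \<in> {0..t}" for n \<tau>
      using diffusion_term_bound[OF m _ \<open>e > 0\<close> K(2) ui[OF that], of "real (Suc n)"]
      by (simp add: A_def c_def algebra_simps)
    then show "\<exists>a. \<forall>n. \<forall>\<tau>\<in>{0..t}. \<bar>LINT x|lebesgue. \<Phi> m (u \<tau> x) *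
        laplacian (\<lambda>x. bump (x /\<^sub>R real (Suc n))) x\<bar> \<le> a * A n \<tau> + \<delta>"
      by blast
  qed
qed

theorem theorem1p2:
  fixes m :: real
    and k l :: "real \<Rightarrow> real"
    and u0 :: "real ^ 'n \<Rightarrow> real"
    and u :: "real \<Rightarrow> real ^ 'n \<Rightarrow> real"
  assumes "CARD('n) \<le> 2 \<longrightarrow> 0 < m \<and> m < 1"
    and "CARD('n) \<ge> 3 \<longrightarrow> (real CARD('n) - 2) / real CARD('n) \<le> m \<and> m < 1"
    and "kernel_pair k l"
    and "integrable lebesgue u0"
    and "continuous_L1 {0..} UNIV u"
    and "L1_solution m l u0 u"
  shows "\<forall>t>0. (LINT x|lebesgue. u t x) = (LINT x|lebesgue. u0 x)"
proof -
  note u = \<open>continuous_L1 {0..} UNIV u\<close>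
  have m: "0 < m \<and> m < 1 \<and> real CARD('n) - 2 \<le> real CARD('n) * m"
  proof (cases "CARD('n) \<le> 2")
    case True
    then have "0 < m" "m < 1" using assms(1) by auto
    moreover have "real CARD('n) - 2 \<le> 0" using True by simp
    moreover have "0 \<le> real CARD('n) * m" using \<open>0 < m\<close> by simp
    ultimately show ?thesis by linarith
  next
    case False
    then have N: "real CARD('n) > 2" and *: "(real CARD('n) - 2) / real CARD('n) \<le> m" "m < 1"
      using assms(2) by auto
    have "0 < (real CARD('n) - 2) / real CARD('n)" using N by simp
    with * have "0 < m" by linarith
    with * N show ?thesis by (simp add: field_simps)
  qed
  note weak_equation = \<open>L1_solution m l u0 u\<close>[unfolded L1_solution_def,
      THEN conjunct2, THEN conjunct2, THEN conjunct2, THEN spec, THEN mp]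
  \<comment> \<open>The equation gives mass conservation at almost every time only; continuity of the mass
    makes the set of good times closed, and a closed set of full measure in \<open>{0<..}\<close>
    contains \<open>{0<..}\<close>.\<close>
  define C where "C = {t \<in> {0..}. integral\<^sup>L lebesgue (u t) = integral\<^sup>L lebesgue u0}"
  have "continuous_on {0..} (\<lambda>t. integral\<^sup>L lebesgue (u t))"
    using u abs_integral_diff_le_L1_norm by (rule continuous_on_L1_contraction)
  then have "closed C"
    unfolding C_def by (rule continuous_closed_preimage_constant) simp
  have "AE t in lebesgue. \<forall>n. t > 0 \<longrightarrow>
      (LINT x|lebesgue. (u t x - u0 x) * bump (x /\<^sub>R real (Suc n))) =
      time_conv l (\<lambda>\<tau>. LINT x|lebesgue. \<Phi> m (u \<tau> x) *
        laplacian (\<lambda>x. bump (x /\<^sub>R real (Suc n))) x) t"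
    \<comment> \<open>Each test function has its own exceptional null set; using only the countably many radii
      \<open>Suc n\<close> gives a common one.\<close>
    unfolding AE_all_countable
  proof
    fix n
    have "test_function (\<lambda>x::real^'n. bump (x /\<^sub>R real (Suc n)))"
      by (rule test_function_scaled_bump) simp
    then show "AE t in lebesgue. t > 0 \<longrightarrow>
        (LINT x|lebesgue. (u t x - u0 x) * bump (x /\<^sub>R real (Suc n))) =
        time_conv l (\<lambda>\<tau>. LINT x|lebesgue. \<Phi> m (u \<tau> x) *
          laplacian (\<lambda>x. bump (x /\<^sub>R real (Suc n))) x) t"
      by (rule weak_equation)
  qed
  then have "AE t \<in> {0<..} in lebesgue. t \<in> C"
  proof eventually_elim
    case (elim t)
    show ?case
    proof
      assume "t \<in> {0<..}"
      then have t: "t > 0" by simp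
      have ut: "integrable lebesgue (u t)" using continuous_L1_imp_integrable[OF u] t by simp
      have l: "set_integrable lebesgue {0..t} l"
        using \<open>kernel_pair k l\<close> t by (simp add: kernel_pair_def kernel_function_def)
      have "(\<lambda>n. LINT x|lebesgue. (u t x - u0 x) * bump (x /\<^sub>R real (Suc n)))
          \<longlonglongrightarrow> (LINT x|lebesgue. u t x - u0 x)"
        using ut assms(4) by (intro integral_times_scaled_bump_tendsto) simp
      moreover have "(\<lambda>n. LINT x|lebesgue. (u t x - u0 x) * bump (x /\<^sub>R real (Suc n))) \<longlonglongrightarrow> 0"
        unfolding elim[THEN spec, THEN mp, OF t]
        by (rule time_conv_diffusion_term_tendsto_0[OF _ _ _ l u]) (use m in auto)
      ultimately have "(LINT x|lebesgue. u t x - u0 x) = 0"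
        by (rule LIMSEQ_unique)
      then show "t \<in> C" using ut assms(4) t by (simp add: C_def)
    qed
  qed
  then have "t \<in> C" if "t > 0" for t
    by (rule mem_closed_if_AE_lebesgue_open[OF open_greaterThan \<open>closed C\<close>]) (use that in simp)
  then show ?thesis by (simp add: C_def)
qed

end
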